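(* Let $f:\mathbb{N}\to\mathbb{N}$ be a non-decreasing significantly sublinear function, and let $\mathcal{G}$ be a class of graphs closed under taking subgraphs that has $f$-separators. For every integer $t>0$ and real $\alpha>0$ there exists $\delta>0$ such that every $G\in\mathcal{G}$ with $|E(G)|\le(t-\alpha)|V(G)|$ contains at least $\delta|V(G)|$ pairwise disjoint $t$-islands.
   Context: All graphs are finite and simple. A separation of $G$ is a pair $(L,R)$ of subgraphs with $G=L\cup R$; its order is $|V(L\cap R)|$. For a non-decreasing $f:\mathbb{N}\to\mathbb{N}$, a class $\mathcal{G}$ has $f$-separators if every $G\in\mathcal{G}$ has a separation $(L,R)$ of order at most $f(|V(G)|)$ with $|V(L)\setminus V(R)|,|V(R)\setminus V(L)|\le\frac23|V(G)|$. $f$ is significantly sublinear if $\sum_{i\ge0} f((3/2)^i)/(3/2)^i$ is finite. A $t$-island in $G$ is a non-empty $S\subseteq V(G)$ such that every vertex of $S$ has fewer than $t$ neighbors in $V(G)\setminus S$. *)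

theory Defs
  imports Complex_Main
begin

datatype 'a ugraph = UGraph (verts: "'a set") (edges: "'a set set")

definition simple_graph :: "'a ugraph \<Rightarrow> bool" where
  "simple_graph G \<longleftrightarrow>
     finite (verts G) \<and> (\<forall>e\<in>edges G. e \<subseteq> verts G \<and> card e = 2)"

definition subgraph :: "'a ugraph \<Rightarrow> 'a ugraph \<Rightarrow> bool" where
  "subgraph H G \<longleftrightarrow> simple_graph H \<and> verts H \<subseteq> verts G \<and> edges H \<subseteq> edges G"

definition graph_union :: "'a ugraph \<Rightarrow> 'a ugraph \<Rightarrow> 'a ugraph" where
  "graph_union L R = UGraph (verts L \<union> verts R) (edges L \<union> edges R)"

definition graph_inter :: "'a ugraph \<Rightarrow> 'a ugraph \<Rightarrow> 'a ugraph" where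
  "graph_inter L R = UGraph (verts L \<inter> verts R) (edges L \<inter> edges R)"

definition separation :: "'a ugraph \<Rightarrow> 'a ugraph \<Rightarrow> 'a ugraph \<Rightarrow> bool" where
  "separation G L R \<longleftrightarrow> subgraph L G \<and> subgraph R G \<and> G = graph_union L R"

definition separation_order :: "'a ugraph \<Rightarrow> 'a ugraph \<Rightarrow> nat" where
  "separation_order L R = card (verts (graph_inter L R))"

text \<open>A class of graphs is a set of graphs whose vertices are drawn from an arbitrary type.
  Closure under isomorphism is not required: all notions below are isomorphism invariant.\<close>

definition graph_class :: "'a ugraph set \<Rightarrow> bool" where
  "graph_class \<G> \<longleftrightarrow> (\<forall>G\<in>\<G>. simple_graph G)"

definition subgraph_closed :: "'a ugraph set \<Rightarrow> bool" where
  "subgraph_closed \<G> \<longleftrightarrow> (\<forall>G\<in>\<G>. \<forall>H. subgraph H G \<longrightarrow> H \<in> \<G>)"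

definition has_separators :: "(nat \<Rightarrow> nat) \<Rightarrow> 'a ugraph set \<Rightarrow> bool" where
  "has_separators f \<G> \<longleftrightarrow>
     (\<forall>G\<in>\<G>. \<exists>L R. separation G L R \<and>
        separation_order L R \<le> f (card (verts G)) \<and>
        real (card (verts L - verts R)) \<le> 2 / 3 * real (card (verts G)) \<and>
        real (card (verts R - verts L)) \<le> 2 / 3 * real (card (verts G)))"

text \<open>The argument \<open>(3/2)^i\<close> of \<open>f\<close> is rounded down to a natural number. For non-decreasing
  \<open>f\<close>, rounding up gives the same notion, because
  \<open>\<lceil>(3/2)^i\<rceil> \<le> \<lfloor>(3/2)^(i+2)\<rfloor>\<close> for every \<open>i\<close>.\<close>

definition significantly_sublinear :: "(nat \<Rightarrow> nat) \<Rightarrow> bool" where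
  "significantly_sublinear f \<longleftrightarrow>
     summable (\<lambda>i. real (f (nat \<lfloor>(3 / 2 :: real) ^ i\<rfloor>)) / (3 / 2) ^ i)"

definition island :: "nat \<Rightarrow> 'a ugraph \<Rightarrow> 'a set \<Rightarrow> bool" where
  "island t G S \<longleftrightarrow>
     S \<noteq> {} \<and> S \<subseteq> verts G \<and>
     (\<forall>v\<in>S. card {u \<in> verts G - S. {u, v} \<in> edges G} < t)"

end

theory Submission
  imports Defs
begin

text \<open>Splitting a vertex set recursively along separators, down to pieces of bounded size, discards
  only a small fraction of the vertices, because \<open>f\<close> is significantly sublinear. Deleting vertices
  with at least \<open>t\<close> neighbours outside from a piece one at a time either stops at an island or shows
  that the piece \<open>P\<close> meets at least \<open>t |P|\<close> edges. No edge meets two pieces, so if few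
  pieces contained an island, then the graph would have more than \<open>(t - \<alpha>) |V(G)|\<close> edges.\<close>

definition incident_edges :: "'a ugraph \<Rightarrow> 'a set \<Rightarrow> 'a set set" where
  "incident_edges G A = {e \<in> edges G. e \<inter> A \<noteq> {}}"

definition induced_subgraph :: "'a ugraph \<Rightarrow> 'a set \<Rightarrow> 'a ugraph" where
  "induced_subgraph G A = UGraph A {e \<in> edges G. e \<subseteq> A}"

lemma simple_graph_finite_edges: "simple_graph G \<Longrightarrow> finite (edges G)"
  unfolding simple_graph_def by (auto intro!: finite_subset[of "edges G" "Pow (verts G)"])

lemma finite_incident_edges: "simple_graph G \<Longrightarrow> finite (incident_edges G A)"
  by (simp add: incident_edges_def simple_graph_finite_edges)

lemma induced_subgraph_subgraph:
  "simple_graph G \<Longrightarrow> A \<subseteq> verts G \<Longrightarrow> subgraph (induced_subgraph G A) G"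
  unfolding simple_graph_def subgraph_def induced_subgraph_def
  by (simp add: finite_subset)

text \<open>Remove a vertex \<open>v\<close> with at least \<open>t\<close> neighbours outside
  \<open>A\<close>: the edges from \<open>v\<close> to these neighbours miss \<open>A - {v}\<close>,
  so each removal accounts for at least \<open>t\<close> new edges. This is why edges leaving
  \<open>A\<close> must be counted too.\<close>

lemma card_incident_edges_no_island:
  assumes G: "simple_graph G" and "finite A" and "A \<subseteq> verts G"
    and "\<And>S. S \<subseteq> A \<Longrightarrow> \<not> island t G S"
  shows "t * card A \<le> card (incident_edges G A)"
  using assms(2-)
proof (induction A rule: finite_psubset_induct)
  case (psubset A)
  show ?case
  proof (cases "A = {}")
    case False
    \<comment> \<open>\<open>A\<close> itself is non-empty and not an island, so some vertex
      violates the degree condition.\<close>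
    then obtain v where v: "v \<in> A" "card {u \<in> verts G - A. {u, v} \<in> edges G} \<ge> t"
      using psubset.prems unfolding island_def by (meson not_le subset_refl)
    let ?N = "{u \<in> verts G - A. {u, v} \<in> edges G}"
    let ?E = "(\<lambda>u. {u, v}) ` ?N"
    have IH: "t * card (A - {v}) \<le> card (incident_edges G (A - {v}))"
      using psubset v by (intro psubset.IH) auto
    have "inj_on (\<lambda>u. {u, v}) ?N"
      by (auto simp: inj_on_def doubleton_eq_iff)
    then have cE: "card ?E = card ?N" by (rule card_image)
    have finN: "finite ?N" using G by (simp add: simple_graph_def)
    have "t * card A = t * card (A - {v}) + t"
      using card.remove[OF psubset.hyps v(1)] by simp
    also have "\<dots> \<le> card (incident_edges G (A - {v})) + card ?E"
      using IH v cE by simp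
    also have "\<dots> = card (incident_edges G (A - {v}) \<union> ?E)"
      using finN finite_incident_edges[OF G]
      by (intro card_Un_disjoint[symmetric]) (auto simp: incident_edges_def)
    also have "\<dots> \<le> card (incident_edges G A)"
      using v by (intro card_mono finite_incident_edges G) (auto simp: incident_edges_def)
    finally show ?thesis .
  qed simp
qed

text \<open>Separate the induced subgraph on \<open>A\<close> and take the two sides without the
  separator. The separation controls only edges inside \<open>A\<close>, hence the restriction to
  \<open>Pow A\<close>.\<close>

lemma has_separators_split:
  assumes "subgraph_closed \<G>" and "has_separators f \<G>" and "G \<in> \<G>" and G: "simple_graph G"
    and A: "A \<subseteq> verts G"
  obtains B C where "B \<subseteq> A" "C \<subseteq> A" "B \<inter> C = {}"
    "real (card B) \<le> 2 / 3 * real (card A)" "real (card C) \<le> 2 / 3 * real (card A)"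
    "card A \<le> card B + card C + f (card A)"
    "incident_edges G B \<inter> incident_edges G C \<inter> Pow A = {}"
proof -
  have "induced_subgraph G A \<in> \<G>"
    using assms induced_subgraph_subgraph unfolding subgraph_closed_def by blast
  moreover have "verts (induced_subgraph G A) = A"
    by (simp add: induced_subgraph_def)
  ultimately obtain L R where sep: "separation (induced_subgraph G A) L R"
    and ord: "separation_order L R \<le> f (card A)"
    and L: "real (card (verts L - verts R)) \<le> 2 / 3 * real (card A)"
    and R: "real (card (verts R - verts L)) \<le> 2 / 3 * real (card A)"
    using assms(2) unfolding has_separators_def by metis
  let ?B = "verts L - verts R" and ?C = "verts R - verts L"
  have U: "A = verts L \<union> verts R" "{e \<in> edges G. e \<subseteq> A} = edges L \<union> edges R"
    using sep by (auto simp: separation_def graph_union_def induced_subgraph_def)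
  have "A = (?B \<union> ?C) \<union> (verts L \<inter> verts R)" using U by auto
  then have "card A \<le> card ?B + card ?C + card (verts L \<inter> verts R)"
    by (metis (no_types, lifting) card_Un_le add_le_mono1 order_trans)
  then have cA: "card A \<le> card ?B + card ?C + f (card A)"
    using ord by (simp add: separation_order_def graph_inter_def)
  have "e \<subseteq> verts L \<or> e \<subseteq> verts R" if "e \<in> edges G" "e \<subseteq> A" for e
  proof -
    have "e \<in> edges L \<or> e \<in> edges R" using that U(2) by blast
    moreover have "\<forall>e\<in>edges L. e \<subseteq> verts L" "\<forall>e\<in>edges R. e \<subseteq> verts R"
      using sep by (simp_all add: separation_def subgraph_def simple_graph_def)
    ultimately show ?thesis by blast
  qed
  then have "incident_edges G ?B \<inter> incident_edges G ?C \<inter> Pow A = {}"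
    unfolding incident_edges_def by blast
  then show ?thesis
    using L R cA U(1) by (intro that[of ?B ?C]) auto
qed

text \<open>An edge has only two ends, one in each set. This serves to lift the restriction to
  \<open>Pow A\<close> after a split.\<close>

lemma simple_graph_edge_meeting_disjoint_subset:
  assumes "simple_graph G" "e \<in> edges G" "B \<inter> C = {}" "e \<inter> B \<noteq> {}" "e \<inter> C \<noteq> {}"
  shows "e \<subseteq> B \<union> C"
proof -
  have "card e = 2" using assms(1,2) by (simp add: simple_graph_def)
  then obtain x y where "e = {x, y}" by (auto simp: card_2_iff)
  then show ?thesis using assms(3-) by auto
qed

text \<open>Sets of size at most \<open>(3/2)^k\<close> are not split: each either contains an
  island, charged with \<open>t * (3/2)^k\<close>, or meets enough edges. Splitting a set of size in
  \<open>((3/2)^(j-1), (3/2)^j]\<close> loses at most a fraction \<open>3/2 * a j\<close> of it; the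
  factor on the left accumulates these losses.\<close>

lemma islands_vs_incident_edges:
  fixes f :: "nat \<Rightarrow> nat" and t :: nat
  defines "a \<equiv> \<lambda>i. real (f (nat \<lfloor>(3 / 2 :: real) ^ i\<rfloor>)) / (3 / 2) ^ i"
  assumes f: "mono f" and \<G>: "subgraph_closed \<G>" "has_separators f \<G>"
    and G: "G \<in> \<G>" "simple_graph G" and "k \<le> i"
    and "A \<subseteq> verts G" and "real (card A) \<le> (3 / 2) ^ i"
  shows "\<exists>\<I>. finite \<I> \<and> (\<forall>S\<in>\<I>. island t G S \<and> S \<subseteq> A) \<and> pairwise disjnt \<I> \<and>
    real t * real (card A) * (1 - 3 / 2 * sum a {Suc k..<Suc i})
      \<le> real (card (incident_edges G A)) + real t * (3 / 2) ^ k * real (card \<I>)"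
  using \<open>k \<le> i\<close> assms(8-)
proof (induction i arbitrary: A rule: dec_induct)
  case base
  have finA: "finite A" using G base by (auto simp: simple_graph_def intro: finite_subset)
  show ?case
  proof (cases "\<exists>S. S \<subseteq> A \<and> island t G S")
    case True
    then obtain S where S: "S \<subseteq> A" "island t G S" by blast
    \<comment> \<open>One island pays for the whole piece; the sum of losses is still empty at this
      level.\<close>
    have "real t * real (card A) \<le> real t * (3 / 2) ^ k"
      using base by (intro mult_left_mono) auto
    then show ?thesis
      using S by (intro exI[of _ "{S}"]) auto
  next
    case False
    then have "t * card A \<le> card (incident_edges G A)"
      using finA G base by (intro card_incident_edges_no_island) auto
    then have "real t * real (card A) \<le> real (card (incident_edges G A))"
      by (metis of_nat_le_iff of_nat_mult)
    then show ?thesis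
      by (intro exI[of _ "{}"]) auto
  qed
next
  case (step i)
  define s where "s = 3 / 2 * sum a {Suc k..<Suc i}"
  have a0: "a j \<ge> 0" for j by (simp add: a_def)
  have s0: "s \<ge> 0" unfolding s_def by (simp add: a0 sum_nonneg)
  have s_Suc: "3 / 2 * sum a {Suc k..<Suc (Suc i)} = s + 3 / 2 * a (Suc i)"
    using step.hyps by (simp add: s_def algebra_simps)
  show ?case
  \<comment> \<open>Only sets larger than \<open>(3/2)^i\<close> are split, so that the separator is
    small relative to \<open>card A\<close>.\<close>
  proof (cases "real (card A) \<le> (3 / 2) ^ i")
    case True
    then obtain \<I> where \<I>: "finite \<I>" "\<forall>S\<in>\<I>. island t G S \<and> S \<subseteq> A" "pairwise disjnt \<I>"
      and le: "real t * real (card A) * (1 - s)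
        \<le> real (card (incident_edges G A)) + real t * (3 / 2) ^ k * real (card \<I>)"
      using step.IH[OF step.prems(1)] unfolding s_def by blast
    have "real t * real (card A) * (1 - (s + 3 / 2 * a (Suc i))) \<le> real t * real (card A) * (1 - s)"
      using a0[of "Suc i"] by (intro mult_left_mono) auto
    with \<I> le show ?thesis unfolding s_Suc by (intro exI[of _ \<I>]) linarith
  next
    case False
    obtain B C where BC: "B \<subseteq> A" "C \<subseteq> A" "B \<inter> C = {}"
      "real (card B) \<le> 2 / 3 * real (card A)" "real (card C) \<le> 2 / 3 * real (card A)"
      "card A \<le> card B + card C + f (card A)"
      "incident_edges G B \<inter> incident_edges G C \<inter> Pow A = {}"
      using has_separators_split[OF \<G> G step.prems(1)] by blast
    \<comment> \<open>Two thirds of \<open>(3/2)^Suc i\<close> is \<open>(3/2)^i\<close>, so both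
      sides drop one level.\<close>
    have small: "real (card B) \<le> (3 / 2) ^ i" "real (card C) \<le> (3 / 2) ^ i"
      using BC(4,5) step.prems(2) by auto
    have sub: "B \<subseteq> verts G" "C \<subseteq> verts G"
      using BC(1,2) step.prems(1) by auto
    obtain \<I> where
      \<I>: "finite \<I>" "\<forall>S\<in>\<I>. island t G S \<and> S \<subseteq> B" "pairwise disjnt \<I>"
        "real t * real (card B) * (1 - s)
          \<le> real (card (incident_edges G B)) + real t * (3 / 2) ^ k * real (card \<I>)"
      using step.IH[OF sub(1) small(1)] unfolding s_def by blast
    obtain \<J> where
      \<J>: "finite \<J>" "\<forall>S\<in>\<J>. island t G S \<and> S \<subseteq> C" "pairwise disjnt \<J>"
        "real t * real (card C) * (1 - s)
          \<le> real (card (incident_edges G C)) + real t * (3 / 2) ^ k * real (card \<J>)"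
      using step.IH[OF sub(2) small(2)] unfolding s_def by blast
    have finA: "finite A" using G step.prems by (auto simp: simple_graph_def intro: finite_subset)
    have "incident_edges G B \<inter> incident_edges G C = {}"
    proof -
      have "e \<subseteq> A" if "e \<in> incident_edges G B" "e \<in> incident_edges G C" for e
        using simple_graph_edge_meeting_disjoint_subset[OF G(2) _ BC(3)] that BC(1,2)
        unfolding incident_edges_def by blast
      then show ?thesis using BC(7) by blast
    qed
    then have "card (incident_edges G B) + card (incident_edges G C)
        = card (incident_edges G B \<union> incident_edges G C)"
      by (simp add: card_Un_disjoint finite_incident_edges G)
    also have "\<dots> \<le> card (incident_edges G A)"
      using BC by (intro card_mono finite_incident_edges G) (auto simp: incident_edges_def)
    finally have inc: "real (card (incident_edges G B)) + real (card (incident_edges G C))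
        \<le> real (card (incident_edges G A))" by linarith
    have dST: "disjnt S T" if "S \<in> \<I>" "T \<in> \<J>" for S T
    proof -
      have "S \<subseteq> B" "T \<subseteq> C" using that \<I>(2) \<J>(2) by simp_all
      with BC(3) show ?thesis unfolding disjnt_def by blast
    qed
    \<comment> \<open>Islands are non-empty, so no set is in both families and their cardinalities
      add.\<close>
    have "{} \<notin> \<I>" using \<I>(2) by (auto simp: island_def)
    then have disj: "\<I> \<inter> \<J> = {}" using dST by (metis disjnt_self_iff_empty disjoint_iff)
    have card_IJ: "card (\<I> \<union> \<J>) = card \<I> + card \<J>"
      using \<I>(1) \<J>(1) disj by (rule card_Un_disjoint)
    have pw: "pairwise disjnt (\<I> \<union> \<J>)"
      using \<I>(3) \<J>(3) by (auto simp: pairwise_def dST disjnt_sym[OF dST])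
    have "f (card A) \<le> f (nat \<lfloor>(3 / 2 :: real) ^ Suc i\<rfloor>)"
      using step.prems(2) by (intro monoD[OF f]) (simp add: le_nat_floor)
    then have "real (f (card A)) \<le> (3 / 2) ^ Suc i * a (Suc i)"
      by (simp add: a_def)
    also have "\<dots> = (3 / 2) ^ i * (3 / 2 * a (Suc i))"
      by simp
    \<comment> \<open>The factor \<open>3/2\<close> is the ratio between the upper bound on
      \<open>card A\<close> and its lower bound \<open>(3/2)^i\<close>.\<close>
    also have "\<dots> \<le> real (card A) * (3 / 2 * a (Suc i))"
      using False a0[of "Suc i"] by (intro mult_right_mono) auto
    finally have fA: "real (f (card A)) \<le> real (card A) * (3 / 2 * a (Suc i))" .
    have cBC: "real (card B) + real (card C) \<le> real (card A)"
      using card_mono[OF finA, of "B \<union> C"] BC(1-3) finite_subset[OF _ finA]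
      by (simp add: card_Un_disjoint)
    have "real (card A) * (1 - (s + 3 / 2 * a (Suc i)))
        = real (card A) - real (card A) * (3 / 2 * a (Suc i)) - s * real (card A)"
      by (simp add: algebra_simps)
    \<comment> \<open>Bounding the \<open>s\<close> term separately avoids any assumption on the
      sign of \<open>1 - s\<close>.\<close>
    also have "\<dots> \<le> (real (card B) + real (card C)) - s * (real (card B) + real (card C))"
      using fA BC(6) mult_left_mono[OF cBC s0] by linarith
    also have "\<dots> = (real (card B) + real (card C)) * (1 - s)"
      by (simp add: algebra_simps)
    finally have "real t * (real (card A) * (1 - (s + 3 / 2 * a (Suc i))))
        \<le> real t * ((real (card B) + real (card C)) * (1 - s))"
      by (rule mult_left_mono) simp
    also have "\<dots> = real t * real (card B) * (1 - s) + real t * real (card C) * (1 - s)"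
      by (simp add: algebra_simps)
    also have "\<dots> \<le> real (card (incident_edges G A))
        + (real t * (3 / 2) ^ k * real (card \<I>) + real t * (3 / 2) ^ k * real (card \<J>))"
      using \<I>(4) \<J>(4) inc by linarith
    also have "\<dots> = real (card (incident_edges G A))
        + real t * (3 / 2) ^ k * real (card (\<I> \<union> \<J>))"
      by (simp add: card_IJ algebra_simps)
    finally have "real t * real (card A) * (1 - (s + 3 / 2 * a (Suc i)))
      \<le> real (card (incident_edges G A)) + real t * (3 / 2) ^ k * real (card (\<I> \<union> \<J>))"
      by (simp add: mult.assoc)
    moreover have "\<forall>S\<in>\<I> \<union> \<J>. island t G S \<and> S \<subseteq> A"
      using \<I>(2) \<J>(2) BC(1,2) by (metis Un_iff subset_trans)
    moreover have "finite (\<I> \<union> \<J>)"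
      using \<I>(1) \<J>(1) by simp
    ultimately show ?thesis
      unfolding s_Suc using pw by (intro exI[of _ "\<I> \<union> \<J>"] conjI)
  qed
qed

theorem theorem22:
  fixes f :: "nat \<Rightarrow> nat" and \<G> :: "'a ugraph set" and t :: nat and \<alpha> :: real
  assumes "mono f"
    and "significantly_sublinear f"
    and "graph_class \<G>"
    and "subgraph_closed \<G>"
    and "has_separators f \<G>"
    and "t > 0"
    and "\<alpha> > 0"
  shows "\<exists>\<delta>::real. \<delta> > 0 \<and>
    (\<forall>G\<in>\<G>. real (card (edges G)) \<le> (real t - \<alpha>) * real (card (verts G)) \<longrightarrow>
      (\<exists>\<I>. (\<forall>S\<in>\<I>. island t G S) \<and> pairwise disjnt \<I> \<and>
           real (card \<I>) \<ge> \<delta> * real (card (verts G))))"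
proof -
  let ?a = "\<lambda>i. real (f (nat \<lfloor>(3 / 2 :: real) ^ i\<rfloor>)) / (3 / 2) ^ i"
  have "summable ?a" using assms(2) by (simp add: significantly_sublinear_def)
  moreover have "\<alpha> / (3 * real t) > 0" using assms by simp
  \<comment> \<open>After multiplication by \<open>3/2\<close> this tail bound becomes
    \<open>\<alpha> / (2 * t)\<close>, so the losses use up half of the slack
    \<open>\<alpha>\<close>.\<close>
  ultimately obtain N where N: "\<And>m n. m \<ge> N \<Longrightarrow> norm (sum ?a {m..<n}) < \<alpha> / (3 * real t)"
    unfolding summable_Cauchy by blast
  let ?K = "(3 / 2 :: real) ^ N"
  \<comment> \<open>The other half of the slack, \<open>\<alpha> * ?n / 2\<close>, must be covered
    by islands worth \<open>t * ?K\<close> each.\<close>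
  define \<delta> where "\<delta> = \<alpha> / (2 * real t * ?K)"
  have "\<delta> > 0" using assms by (simp add: \<delta>_def)
  moreover have "\<exists>\<I>. (\<forall>S\<in>\<I>. island t G S) \<and> pairwise disjnt \<I> \<and>
           real (card \<I>) \<ge> \<delta> * real (card (verts G))"
    if G: "G \<in> \<G>" and E: "real (card (edges G)) \<le> (real t - \<alpha>) * real (card (verts G))" for G
  proof -
    have sG: "simple_graph G" using assms(3) G by (simp add: graph_class_def)
    let ?n = "real (card (verts G))"
    \<comment> \<open>Only the starting level \<open>i\<close> depends on \<open>G\<close>;
      \<open>N\<close>, and with it \<open>\<delta>\<close>, does not.\<close>
    obtain i0 where "?n < (3 / 2) ^ i0" using real_arch_pow[of "3/2" ?n] by auto
    also have "\<dots> \<le> (3 / 2 :: real) ^ (max N i0)" by (intro power_increasing) auto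
    finally obtain i where i: "N \<le> i" "?n \<le> (3 / 2) ^ i" by (meson less_imp_le max.cobounded1)
    obtain \<I> where \<I>: "\<forall>S\<in>\<I>. island t G S \<and> S \<subseteq> verts G" "pairwise disjnt \<I>"
      "real t * ?n * (1 - 3 / 2 * sum ?a {Suc N..<Suc i})
        \<le> real (card (incident_edges G (verts G))) + real t * ?K * real (card \<I>)"
      using islands_vs_incident_edges[OF assms(1,4,5) G sG i(1) subset_refl i(2)] by blast
    have "card (incident_edges G (verts G)) \<le> card (edges G)"
      by (intro card_mono simple_graph_finite_edges sG) (auto simp: incident_edges_def)
    then have inc: "real (card (incident_edges G (verts G))) \<le> (real t - \<alpha>) * ?n"
      using E by linarith
    have "sum ?a {Suc N..<Suc i} \<le> \<alpha> / (3 * real t)"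
      using N[of "Suc N" "Suc i"] by simp
    then have "3 / 2 * sum ?a {Suc N..<Suc i} \<le> \<alpha> / (2 * real t)"
      by simp
    then have "real t * ?n * (1 - \<alpha> / (2 * real t))
        \<le> real t * ?n * (1 - 3 / 2 * sum ?a {Suc N..<Suc i})"
      by (intro mult_left_mono) auto
    moreover have "real t * ?n * (1 - \<alpha> / (2 * real t)) = real t * ?n - \<alpha> * ?n / 2"
      using assms(6) by (simp add: field_simps)
    \<comment> \<open>The terms \<open>t * ?n\<close> cancel, leaving the gap between
      \<open>\<alpha> * ?n\<close> and \<open>\<alpha> * ?n / 2\<close>.\<close>
    ultimately have "\<alpha> * ?n / 2 \<le> real t * ?K * real (card \<I>)"
      using \<I>(3) inc by (simp add: left_diff_distrib)
    then have "\<delta> * ?n \<le> real (card \<I>)"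
      using assms(6) unfolding \<delta>_def by (simp add: divide_le_eq mult_ac)
    with \<I> show ?thesis by blast
  qed
  ultimately show ?thesis by blast
qed

end
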